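(* Let $\Phi$ be the real affine root system of type $D_4^{(3)}$. Then $\Psi\subseteq\Phi$ is a maximal closed subroot system with a proper semi-closed gradient subroot system $\mathrm{Gr}(\Psi)$ if and only if $\mathrm{Gr}(\Psi)=\mathring\Phi_s$ and $\Psi=\Psi(i,j,k;\ell)$ for some permutation $\{i,j,k\}$ of $I_3=\{1,2,3\}$ and some $\ell\in\mathbb Z$ satisfying $\ell\equiv1$ or $2\pmod 3$. The type of $\Psi(i,j,k;\ell)$ is $A_2^{(1)}$.
   Context: $\epsilon_1,\epsilon_2,\epsilon_3$ are orthonormal and $\delta$ is a vector linearly independent of them with $(\delta,\cdot)=0$. With $\{i,j,k\}=\{1,2,3\}$ throughout, $$\mathring\Phi=\{\epsilon_i-\epsilon_j\ (i\ne j)\}\cup\{\pm(\epsilon_i+\epsilon_j-2\epsilon_k)\}$$ (type $G_2$; short roots $\mathring\Phi_s=\{\epsilon_i-\epsilon_j:i\neq j\}$, long roots $\pm(\epsilon_i+\epsilon_j-2\epsilon_k)$), and $$\Phi=\{\epsilon_i-\epsilon_j+r\delta,\ \pm(\epsilon_i+\epsilon_j-2\epsilon_k)+3r\delta: r\in\mathbb Z\}.$$ For a permutation $(i,j,k)$ of $(1,2,3)$ and $\ell\in\mathbb Z$ set $$\Psi^+(i,j,k;\ell)=\{\epsilon_i-\epsilon_j+3r\delta,\ \epsilon_j-\epsilon_k+(3r+\ell)\delta,\ \epsilon_i-\epsilon_k+(3r+\ell)\delta:r\in\mathbb Z\}$$ and $\Psi(i,j,k;\ell)=\Psi^+(i,j,k;\ell)\cup(-\Psi^+(i,j,k;\ell))$.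 With $\langle\beta,\alpha^\vee\rangle=2(\beta,\alpha)/(\alpha,\alpha)$ and $\mathbf s_\alpha(\beta)=\beta-\langle\beta,\alpha^\vee\rangle\alpha$, a non-empty subset $\Psi$ of $R$ ($R=\Phi$ or $\mathring\Phi$) is a subroot system if $\mathbf s_\alpha(\beta)\in\Psi$ for all $\alpha,\beta\in\Psi$; it is closed if $\alpha,\beta\in\Psi$, $\alpha+\beta\in R$ imply $\alpha+\beta\in\Psi$. A maximal closed subroot system of $R$ is a proper closed subroot system $\Psi$ such that $\Psi\subseteq\Delta\subsetneq R$ with $\Delta$ a closed subroot system implies $\Delta=\Psi$. The gradient is $\mathrm{Gr}(\Psi)=\{\alpha\in\mathring\Phi:\alpha+r\delta\in\Psi\text{ for some }r\}$. A subroot system $\mathring\Psi$ of $\mathring\Phi$ is semi-closed if it is not closed in $\mathring\Phi$ and, whenever $\alpha,\beta\in\mathring\Psi$ satisfy $\alpha+\beta\in\mathring\Phi\setminus\mathring\Psi$, the roots $\alpha,\beta$ are short and $\alpha+\beta$ is long. Type: an irreducible subroot system $\Psi$ is of type $X_k^{(t)}$ if there is a linear isomorphism from the real span of $\Psi$ onto the real span of the real affine root system of type $X_k^{(t)}$ mapping $\Psi$ onto it and preserving the integers $\langle\beta,\alpha^\vee\rangle$. The real roots of type $A_2^{(1)}$ are $\{\alpha+r\delta:\alpha\in A_2,r\in\mathbb Z\}$. *)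

theory Defs
  imports "HOL-Analysis.Analysis" "HOL-Number_Theory.Cong"
begin

text \<open>
  The form \<open>B\<close> is an argument rather than the inner product of a type class, since it is
  degenerate: \<open>\<delta>\<close> lies in its radical.
\<close>

locale affine_setting =
  fixes B :: "'v::real_vector \<Rightarrow> 'v \<Rightarrow> real"
    and \<epsilon> :: "nat \<Rightarrow> 'v"
    and \<delta> :: 'v
  assumes bilinear_form: "bilinear B"
    and symmetric_form: "B x y = B y x"
    and orthonormal_eps: "\<lbrakk>i \<in> {1,2,3}; j \<in> {1,2,3}\<rbrakk> \<Longrightarrow> B (\<epsilon> i) (\<epsilon> j) = (if i = j then 1 else 0)"
    and null_delta: "B \<delta> x = 0"
    and delta_independent: "\<delta> \<notin> span (\<epsilon> ` {1,2,3})"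

definition cartan_int :: "('v \<Rightarrow> 'v \<Rightarrow> real) \<Rightarrow> 'v \<Rightarrow> 'v \<Rightarrow> real" where
  "cartan_int B \<beta> \<alpha> = 2 * B \<beta> \<alpha> / B \<alpha> \<alpha>"

definition root_reflection :: "('v::real_vector \<Rightarrow> 'v \<Rightarrow> real) \<Rightarrow> 'v \<Rightarrow> 'v \<Rightarrow> 'v" where
  "root_reflection B \<alpha> \<beta> = \<beta> - cartan_int B \<beta> \<alpha> *\<^sub>R \<alpha>"

definition subroot_system :: "('v::real_vector \<Rightarrow> 'v \<Rightarrow> real) \<Rightarrow> 'v set \<Rightarrow> 'v set \<Rightarrow> bool" where
  "subroot_system B R \<Psi> \<longleftrightarrow>
     \<Psi> \<noteq> {} \<and> \<Psi> \<subseteq> R \<and> (\<forall>\<alpha>\<in>\<Psi>. \<forall>\<beta>\<in>\<Psi>. root_reflection B \<alpha> \<beta> \<in> \<Psi>)"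

definition closed_in_roots :: "'v::real_vector set \<Rightarrow> 'v set \<Rightarrow> bool" where
  "closed_in_roots R \<Psi> \<longleftrightarrow> (\<forall>\<alpha>\<in>\<Psi>. \<forall>\<beta>\<in>\<Psi>. \<alpha> + \<beta> \<in> R \<longrightarrow> \<alpha> + \<beta> \<in> \<Psi>)"

definition closed_subroot_system :: "('v::real_vector \<Rightarrow> 'v \<Rightarrow> real) \<Rightarrow> 'v set \<Rightarrow> 'v set \<Rightarrow> bool" where
  "closed_subroot_system B R \<Psi> \<longleftrightarrow> subroot_system B R \<Psi> \<and> closed_in_roots R \<Psi>"

definition maximal_closed_subroot_system ::
    "('v::real_vector \<Rightarrow> 'v \<Rightarrow> real) \<Rightarrow> 'v set \<Rightarrow> 'v set \<Rightarrow> bool" where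
  "maximal_closed_subroot_system B R \<Psi> \<longleftrightarrow>
     closed_subroot_system B R \<Psi> \<and> \<Psi> \<noteq> R \<and>
     (\<forall>\<Delta>. closed_subroot_system B R \<Delta> \<and> \<Psi> \<subseteq> \<Delta> \<and> \<Delta> \<subset> R \<longrightarrow> \<Delta> = \<Psi>)"

definition G2_short :: "(nat \<Rightarrow> 'v::real_vector) \<Rightarrow> 'v set" where
  "G2_short \<epsilon> = {\<epsilon> i - \<epsilon> j | i j. i \<in> {1,2,3} \<and> j \<in> {1,2,3} \<and> i \<noteq> j}"

definition G2_long :: "(nat \<Rightarrow> 'v::real_vector) \<Rightarrow> 'v set" where
  "G2_long \<epsilon> = {\<epsilon> i + \<epsilon> j - 2 *\<^sub>R \<epsilon> k | i j k. {i,j,k} = {1,2,3}} \<union>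
               {- (\<epsilon> i + \<epsilon> j - 2 *\<^sub>R \<epsilon> k) | i j k. {i,j,k} = {1,2,3}}"

definition G2_roots :: "(nat \<Rightarrow> 'v::real_vector) \<Rightarrow> 'v set" where
  "G2_roots \<epsilon> = G2_short \<epsilon> \<union> G2_long \<epsilon>"

definition D4_3_real_roots :: "(nat \<Rightarrow> 'v::real_vector) \<Rightarrow> 'v \<Rightarrow> 'v set" where
  "D4_3_real_roots \<epsilon> \<delta> =
     {\<alpha> + of_int r *\<^sub>R \<delta> | \<alpha> r. \<alpha> \<in> G2_short \<epsilon>} \<union>
     {\<alpha> + of_int (3 * r) *\<^sub>R \<delta> | \<alpha> r. \<alpha> \<in> G2_long \<epsilon>}"

definition gradient :: "(nat \<Rightarrow> 'v::real_vector) \<Rightarrow> 'v \<Rightarrow> 'v set \<Rightarrow> 'v set" where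
  "gradient \<epsilon> \<delta> \<Psi> = {\<alpha> \<in> G2_roots \<epsilon>. \<exists>r::int. \<alpha> + of_int r *\<^sub>R \<delta> \<in> \<Psi>}"

definition semi_closed :: "('v::real_vector \<Rightarrow> 'v \<Rightarrow> real) \<Rightarrow> (nat \<Rightarrow> 'v) \<Rightarrow> 'v set \<Rightarrow> bool" where
  "semi_closed B \<epsilon> \<Psi> \<longleftrightarrow>
     subroot_system B (G2_roots \<epsilon>) \<Psi> \<and> \<not> closed_in_roots (G2_roots \<epsilon>) \<Psi> \<and>
     (\<forall>\<alpha>\<in>\<Psi>. \<forall>\<beta>\<in>\<Psi>. \<alpha> + \<beta> \<in> G2_roots \<epsilon> - \<Psi> \<longrightarrow>
        \<alpha> \<in> G2_short \<epsilon> \<and> \<beta> \<in> G2_short \<epsilon> \<and> \<alpha> + \<beta> \<in> G2_long \<epsilon>)"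

definition Psi_plus :: "(nat \<Rightarrow> 'v::real_vector) \<Rightarrow> 'v \<Rightarrow> nat \<Rightarrow> nat \<Rightarrow> nat \<Rightarrow> int \<Rightarrow> 'v set" where
  "Psi_plus \<epsilon> \<delta> i j k l =
     (\<Union>r::int. {\<epsilon> i - \<epsilon> j + of_int (3 * r) *\<^sub>R \<delta>,
                \<epsilon> j - \<epsilon> k + of_int (3 * r + l) *\<^sub>R \<delta>,
                \<epsilon> i - \<epsilon> k + of_int (3 * r + l) *\<^sub>R \<delta>})"

definition Psi_roots :: "(nat \<Rightarrow> 'v::real_vector) \<Rightarrow> 'v \<Rightarrow> nat \<Rightarrow> nat \<Rightarrow> nat \<Rightarrow> int \<Rightarrow> 'v set" where
  "Psi_roots \<epsilon> \<delta> i j k l = Psi_plus \<epsilon> \<delta> i j k l \<union> uminus ` Psi_plus \<epsilon> \<delta> i j k l"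

definition irreducible_roots :: "('v \<Rightarrow> 'v \<Rightarrow> real) \<Rightarrow> 'v set \<Rightarrow> bool" where
  "irreducible_roots B \<Psi> \<longleftrightarrow>
     \<Psi> \<noteq> {} \<and>
     \<not> (\<exists>P Q. P \<noteq> {} \<and> Q \<noteq> {} \<and> P \<union> Q = \<Psi> \<and> P \<inter> Q = {} \<and> (\<forall>\<alpha>\<in>P. \<forall>\<beta>\<in>Q. B \<alpha> \<beta> = 0))"

text \<open>
  The isomorphism of spans is given by a linear map on the whole space; every linear map on a
  subspace extends to one.
\<close>

definition root_isomorphic ::
    "('v::real_vector \<Rightarrow> 'v \<Rightarrow> real) \<Rightarrow> 'v set \<Rightarrow> ('w::real_vector \<Rightarrow> 'w \<Rightarrow> real) \<Rightarrow> 'w set \<Rightarrow> bool" where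
  "root_isomorphic B \<Psi> B' X \<longleftrightarrow>
     (\<exists>f. linear f \<and> bij_betw f (span \<Psi>) (span X) \<and> f ` \<Psi> = X \<and>
          (\<forall>\<alpha>\<in>\<Psi>. \<forall>\<beta>\<in>\<Psi>. cartan_int B' (f \<beta>) (f \<alpha>) = cartan_int B \<beta> \<alpha>))"

definition A2_roots :: "(nat \<Rightarrow> 'v::real_vector) \<Rightarrow> 'v set" where
  "A2_roots \<epsilon> = {\<epsilon> i - \<epsilon> j | i j. i \<in> {1,2,3} \<and> j \<in> {1,2,3} \<and> i \<noteq> j}"

definition A2_1_real_roots :: "(nat \<Rightarrow> 'v::real_vector) \<Rightarrow> 'v \<Rightarrow> 'v set" where
  "A2_1_real_roots \<epsilon> \<delta> = {\<alpha> + of_int r *\<^sub>R \<delta> | \<alpha> r. \<alpha> \<in> A2_roots \<epsilon>}"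

text \<open>
  The model of \<open>A\<^sub>2\<^sup>(\<^sup>1\<^sup>)\<close> is realised in the same ambient space as \<open>D\<^sub>4\<^sup>(\<^sup>3\<^sup>)\<close>.
\<close>

definition of_type_A2_1 ::
    "('v::real_vector \<Rightarrow> 'v \<Rightarrow> real) \<Rightarrow> (nat \<Rightarrow> 'v) \<Rightarrow> 'v \<Rightarrow> 'v set \<Rightarrow> bool" where
  "of_type_A2_1 B \<epsilon> \<delta> \<Psi> \<longleftrightarrow>
     subroot_system B (D4_3_real_roots \<epsilon> \<delta>) \<Psi> \<and> irreducible_roots B \<Psi> \<and>
     root_isomorphic B \<Psi> B (A2_1_real_roots \<epsilon> \<delta>)"

end

theory Submission
  imports Defs
begin

text \<open>
Every subset that matters here consists of short roots \<open>\<epsilon>\<^sub>i - \<epsilon>\<^sub>j + r\<delta>\<close>, and is described by the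
integers \<open>r\<close> that occur for each pair \<open>(i,j)\<close>. A family that behaves well under sums and reflections
has these integers equal to \<open>x\<^sub>i - x\<^sub>j\<close> modulo 3 for some vector \<open>x = (x\<^sub>1,x\<^sub>2,x\<^sub>3)\<close>; write \<open>\<Psi>(x)\<close> for it
(\<open>coset_roots x\<close> below). The set \<open>\<Psi>(i,j,k;\<ell>)\<close> is the case \<open>x\<^sub>i = x\<^sub>j = \<ell>\<close>, \<open>x\<^sub>k = 0\<close>. Working with \<open>x\<close>
restores the symmetry under permutations of the indices.

Two short roots have a long sum exactly when they are \<open>\<epsilon>\<^sub>i - \<epsilon>\<^sub>j + r\<delta>\<close> and \<open>\<epsilon>\<^sub>i - \<epsilon>\<^sub>k + s\<delta>\<close>, up to a
common sign, and \<open>3\<close> divides \<open>r + s\<close>. Inside \<open>\<Psi>(x)\<close> one has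
\<open>r + s \<equiv> 2x\<^sub>i - x\<^sub>j - x\<^sub>k \<equiv> -(x\<^sub>1 + x\<^sub>2 + x\<^sub>3)\<close> modulo 3. So \<open>\<Psi>(x)\<close> is closed as soon as \<open>3\<close> does not
divide \<open>x\<^sub>1 + x\<^sub>2 + x\<^sub>3\<close>. Three residues have a nonzero sum modulo 3 exactly when precisely two of them
agree, and this turns \<open>\<Psi>(x)\<close> into some \<open>\<Psi>(i,j,k;\<ell>)\<close> with \<open>3\<close> not dividing \<open>\<ell>\<close>.

A semi-closed gradient contains two short roots with a long sum that it misses. The two short roots
generate all short roots under reflections, and one long root would bring in all the others; so the
gradient is the set of short roots (\<open>semi_closed_eq_short\<close>). A closed subroot system with this
gradient has no long root, and the residues that it must then avoid force it into some \<open>\<Psi>(x)\<close> that is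
closed (\<open>long_free_closed_subset_coset_roots\<close>). Maximality gives equality.

Conversely, let \<open>\<Delta>\<close> be closed and contain a closed \<open>\<Psi>(x)\<close>. If \<open>\<Delta>\<close> has no long root, the same residue
argument gives \<open>\<Delta> = \<Psi>(x)\<close>. A long root in \<open>\<Delta>\<close> adds to each \<open>x\<^sub>i - x\<^sub>j\<close> the shift \<open>x\<^sub>1 + x\<^sub>2 + x\<^sub>3\<close>, which
is invertible modulo 3, so that \<open>\<Delta>\<close> contains every root (\<open>closed_with_long_is_all\<close>).

For the type, dividing \<open>r - (x\<^sub>i - x\<^sub>j)\<close> by 3 is induced by a linear map that changes vectors only by
multiples of \<open>\<delta>\<close>, hence preserves the form (\<open>coset_roots_isomorphic\<close>).
\<close>

section \<open>The index set\<close>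

text \<open>
A named constant, so that the simplifier does not take the set apart and statements stay symmetric
in the indices.
\<close>
definition three :: "nat set" where "three = {1,2,3}"

lemma three_cases: "i \<in> three \<longleftrightarrow> i = 1 \<or> i = 2 \<or> i = 3"
  by (auto simp: three_def)

lemma permutation_three:
  assumes "{i,j,k} = three"
  shows "i \<in> three" "j \<in> three" "k \<in> three" "i \<noteq> j" "i \<noteq> k" "j \<noteq> k"
proof -
  show "i \<in> three" "j \<in> three" "k \<in> three" using assms by auto
  have "card {i,j,k} = 3" unfolding assms by (simp add: three_def)
  then show "i \<noteq> j" "i \<noteq> k" "j \<noteq> k" by (auto simp: card_insert_if split: if_splits)
qed

lemma permutation_threeI:
  "\<lbrakk>i \<in> three; j \<in> three; k \<in> three; i \<noteq> j; i \<noteq> k; j \<noteq> k\<rbrakk> \<Longrightarrow> {i,j,k} = three"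
  by (rule card_subset_eq) (auto simp: three_def)

lemma third_index:
  assumes "i \<in> three" "j \<in> three" "i \<noteq> j"
  obtains k where "{i,j,k} = three"
proof -
  have "\<exists>k\<in>three. k \<noteq> i \<and> k \<noteq> j" using assms by (auto simp: three_def)
  then show thesis using that assms permutation_threeI by metis
qed

lemma other_indices:
  assumes "i \<in> three"
  obtains j k where "{i,j,k} = three"
proof -
  have "\<exists>j\<in>three. i \<noteq> j" using assms by (auto simp: three_def)
  then show thesis using that third_index assms by metis
qed

lemma sum_three:
  assumes "{i,j,k} = three"
  shows "sum x three = x i + x j + x k"
  using permutation_three[OF assms] by (simp flip: assms add: ac_simps)

section \<open>Short and long roots in coordinates\<close>

context affine_setting
begin

definition short_root :: "nat \<Rightarrow> nat \<Rightarrow> int \<Rightarrow> 'v" where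
  "short_root i j r = \<epsilon> i - \<epsilon> j + of_int r *\<^sub>R \<delta>"

text \<open>
The long root \<open>\<epsilon>\<^sub>i + \<epsilon>\<^sub>j - 2\<epsilon>\<^sub>k\<close> is minus \<open>3\<epsilon>\<^sub>k - (\<epsilon>\<^sub>1 + \<epsilon>\<^sub>2 + \<epsilon>\<^sub>3)\<close>; the latter form needs only the index
that the root singles out.
\<close>

definition long_root :: "nat \<Rightarrow> int \<Rightarrow> 'v" where
  "long_root a r = 3 *\<^sub>R \<epsilon> a - sum \<epsilon> three + of_int r *\<^sub>R \<delta>"

lemmas form_simps =
  bilinear_ladd[OF bilinear_form] bilinear_radd[OF bilinear_form]
  bilinear_lsub[OF bilinear_form] bilinear_rsub[OF bilinear_form]
  bilinear_lmul[OF bilinear_form] bilinear_rmul[OF bilinear_form]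
  bilinear_lneg[OF bilinear_form] bilinear_rneg[OF bilinear_form]

lemma form_eps: "\<lbrakk>i \<in> three; j \<in> three\<rbrakk> \<Longrightarrow> B (\<epsilon> i) (\<epsilon> j) = of_bool (i = j)"
  using orthonormal_eps by (simp add: three_def)

lemma form_eps_sum: "i \<in> three \<Longrightarrow> B (\<epsilon> i) (sum \<epsilon> three) = 1"
  unfolding three_def by (auto simp: form_simps orthonormal_eps)

lemma form_sum_eps: "i \<in> three \<Longrightarrow> B (sum \<epsilon> three) (\<epsilon> i) = 1"
  using form_eps_sum symmetric_form by metis

lemma form_sum_sum: "B (sum \<epsilon> three) (sum \<epsilon> three) = 3"
  by (subst (2) three_def) (simp add: form_simps form_sum_eps three_cases)

lemma form_delta_right: "B x \<delta> = 0"
  using null_delta symmetric_form by metis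

lemma form_short_short:
  assumes "i \<in> three" "j \<in> three" "k \<in> three" "l \<in> three"
  shows "B (short_root i j r) (short_root k l s) =
    of_bool (i = k) - of_bool (i = l) - of_bool (j = k) + of_bool (j = l)"
  unfolding short_root_def form_simps null_delta form_delta_right
  using assms by (simp add: form_eps)

lemma form_long_short:
  assumes "a \<in> three" "i \<in> three" "j \<in> three"
  shows "B (long_root a r) (short_root i j s) = 3 * (of_bool (a = i) - of_bool (a = j))"
  unfolding short_root_def long_root_def form_simps null_delta form_delta_right
  using assms by (simp add: form_eps form_eps_sum form_sum_eps form_sum_sum)

lemma norm_short: "\<lbrakk>i \<in> three; j \<in> three; i \<noteq> j\<rbrakk> \<Longrightarrow> B (short_root i j r) (short_root i j r) = 2"
  by (subst form_short_short) auto

lemma norm_long: "a \<in> three \<Longrightarrow> B (long_root a r) (long_root a r) = 6"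
  unfolding long_root_def form_simps null_delta form_delta_right
  by (simp add: form_eps form_eps_sum form_sum_eps form_sum_sum)

lemma norm_long_neg: "a \<in> three \<Longrightarrow> B (- long_root a r) (- long_root a r) = 6"
  by (simp add: form_simps norm_long)

lemma short_neg: "- short_root i j r = short_root j i (- r)"
  by (simp add: short_root_def)

lemma short_add: "short_root i j r + short_root j k s = short_root i k (r + s)"
  by (simp add: short_root_def algebra_simps)

lemma scaleR_three: "3 *\<^sub>R (v::'v) = v + v + v"
  using scaleR_add_left[of 2 1 v] by (simp add: scaleR_2)

text \<open>
The next two sums are the two ways in which short roots at an angle of 60 degrees add up to a long
root: they share their positive or their negative index.
\<close>

lemma short_add_out:
  "{i,j,k} = three \<Longrightarrow> short_root i j r + short_root i k s = long_root i (r + s)"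
  by (simp add: short_root_def long_root_def sum_three[of i j k] scaleR_three algebra_simps)

lemma short_add_in:
  "{i,j,k} = three \<Longrightarrow> short_root i k r + short_root j k s = - long_root k (- (r + s))"
  by (simp add: short_root_def long_root_def sum_three[of i j k] scaleR_three algebra_simps)

lemma long_add_short:
  "{i,j,k} = three \<Longrightarrow> long_root i r + short_root j i s = short_root i k (r + s)"
  by (simp add: short_root_def long_root_def sum_three[of i j k] scaleR_three algebra_simps)

lemma G2_short_eq: "G2_short \<epsilon> = {short_root i j 0 | i j. i \<in> three \<and> j \<in> three \<and> i \<noteq> j}"
  by (simp add: G2_short_def short_root_def three_def)

lemma perm_long: "{i,j,k} = three \<Longrightarrow> \<epsilon> i + \<epsilon> j - 2 *\<^sub>R \<epsilon> k = - long_root k 0"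
  by (simp add: long_root_def sum_three[of i j k] scaleR_three scaleR_2 algebra_simps)

lemma G2_long_eq: "G2_long \<epsilon> = (\<Union>a\<in>three. {long_root a 0, - long_root a 0})" (is "?L = ?R")
proof
  show "?L \<subseteq> ?R"
  proof
    fix x assume "x \<in> ?L"
    then obtain i j k where p: "{i,j,k} = three"
      and x: "x = \<epsilon> i + \<epsilon> j - 2 *\<^sub>R \<epsilon> k \<or> x = - (\<epsilon> i + \<epsilon> j - 2 *\<^sub>R \<epsilon> k)"
      unfolding G2_long_def three_def by blast
    from p have "k \<in> three" by blast
    with x show "x \<in> ?R" unfolding perm_long[OF p] by auto
  qed
  show "?R \<subseteq> ?L"
  proof
    fix x assume "x \<in> ?R"
    then obtain a where a: "a \<in> three" and x: "x = long_root a 0 \<or> x = - long_root a 0" by blast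
    from a obtain i j where p: "{i,j,a} = three"
      using other_indices by (metis insert_commute)
    have "x = \<epsilon> i + \<epsilon> j - 2 *\<^sub>R \<epsilon> a \<or> x = - (\<epsilon> i + \<epsilon> j - 2 *\<^sub>R \<epsilon> a)"
      using x unfolding perm_long[OF p] by auto
    then show "x \<in> ?L" unfolding G2_long_def using p unfolding three_def by blast
  qed
qed

abbreviation \<Phi> :: "'v set" where "\<Phi> \<equiv> D4_3_real_roots \<epsilon> \<delta>"

lemma root_cases [consumes 1, case_names short long neg_long]:
  assumes "x \<in> \<Phi>"
  obtains i j r where "i \<in> three" "j \<in> three" "i \<noteq> j" "x = short_root i j r"
  | a r where "a \<in> three" "x = long_root a (3 * r)"
  | a r where "a \<in> three" "x = - long_root a (3 * r)"
proof -
  from assms consider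
    \<alpha> r where "\<alpha> \<in> G2_short \<epsilon>" "x = \<alpha> + of_int r *\<^sub>R \<delta>"
    | \<alpha> r where "\<alpha> \<in> G2_long \<epsilon>" "x = \<alpha> + of_int (3 * r) *\<^sub>R \<delta>"
    unfolding D4_3_real_roots_def by blast
  then show thesis
  proof cases
    case 1
    then show thesis using that(1) by (auto simp: G2_short_eq short_root_def)
  next
    case 2
    from 2(1) obtain a where a: "a \<in> three" and \<alpha>: "\<alpha> = long_root a 0 \<or> \<alpha> = - long_root a 0"
      unfolding G2_long_eq by blast
    have "x = long_root a (3 * r) \<or> x = - long_root a (3 * (- r))"
      using \<alpha> 2(2) by (auto simp: long_root_def)
    then show thesis using that(2,3) a by blast
  qed
qed

lemma short_mem_roots: "\<lbrakk>i \<in> three; j \<in> three; i \<noteq> j\<rbrakk> \<Longrightarrow> short_root i j r \<in> \<Phi>"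
  unfolding D4_3_real_roots_def G2_short_def short_root_def three_def by blast

lemma long_eq_finite_plus: "long_root a r = long_root a 0 + of_int r *\<^sub>R \<delta>"
  "- long_root a r = - long_root a 0 + of_int (- r) *\<^sub>R \<delta>"
  by (simp_all add: long_root_def)

lemma long_mem_roots:
  assumes "a \<in> three"
  shows "long_root a (3 * r) \<in> \<Phi>" "- long_root a (3 * r) \<in> \<Phi>"
proof -
  have "\<alpha> \<in> G2_long \<epsilon> \<Longrightarrow> \<alpha> + of_int (3 * m) *\<^sub>R \<delta> \<in> \<Phi>" for \<alpha> m
    unfolding D4_3_real_roots_def by (rule UnI2) auto
  from this[of "long_root a 0" r] this[of "- long_root a 0" "- r"]
  show "long_root a (3 * r) \<in> \<Phi>" "- long_root a (3 * r) \<in> \<Phi>"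
    using assms unfolding long_eq_finite_plus(1)[of a "3*r"] long_eq_finite_plus(2)[of a "3*r"]
    by (auto simp: G2_long_eq)
qed

lemma gradient_iff_short:
  assumes "i \<in> three" "j \<in> three" "i \<noteq> j"
  shows "short_root i j 0 \<in> gradient \<epsilon> \<delta> \<Psi> \<longleftrightarrow> (\<exists>r. short_root i j r \<in> \<Psi>)"
  using assms by (auto simp: gradient_def G2_roots_def G2_short_eq short_root_def)

text \<open>
The form does not see \<open>\<delta>\<close>, so the coefficient of \<open>\<delta>\<close> has to be read off by a separate functional.
\<close>

lemma delta_coefficient:
  obtains c :: "'v \<Rightarrow> real"
  where "linear c" "c \<delta> = 1" "\<And>i. i \<in> three \<Longrightarrow> c (\<epsilon> i) = 0"
proof -
  obtain b where b: "b \<subseteq> \<epsilon> ` three" "independent b" "span b = span (\<epsilon> ` three)"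
    using maximal_independent_subset[of "\<epsilon> ` three"] span_eq
    by (metis span_superset subset_trans)
  have nb: "\<delta> \<notin> span b" using b(3) delta_independent by (simp add: three_def)
  then have "independent (insert \<delta> b)" using b(2) by (simp add: independent_insert)
  from linear_independent_extend[OF this, of "\<lambda>v. if v = \<delta> then 1 else (0::real)"]
  obtain c :: "'v \<Rightarrow> real" where c: "linear c"
    "\<And>v. v \<in> insert \<delta> b \<Longrightarrow> c v = (if v = \<delta> then 1 else 0)" by metis
  have "c v = 0" if "v \<in> b" for v
    using c(2)[of v] that nb span_base by auto
  then have "c v = 0" if "v \<in> span b" for v
    using linear_eq_0_on_span[OF c(1), of b v] that by blast
  then have "c (\<epsilon> i) = 0" if "i \<in> three" for i
    using that by (auto simp: b(3) intro: span_base)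
  moreover have "c \<delta> = 1" using c(2) by simp
  ultimately show thesis using that c(1) by blast
qed

section \<open>Short roots with prescribed residues\<close>

text \<open>
This is the translate by \<open>x\<close>, regarded as a coweight, of the set of all \<open>\<alpha> + 3r\<delta>\<close> with \<open>\<alpha>\<close> short. Only
differences of the entries of \<open>x\<close> modulo 3 matter.
\<close>

definition coset_roots :: "(nat \<Rightarrow> int) \<Rightarrow> 'v set" where
  "coset_roots x =
     {short_root i j r | i j r. i \<in> three \<and> j \<in> three \<and> i \<noteq> j \<and> 3 dvd r - (x i - x j)}"

lemma coset_rootsI:
  "\<lbrakk>i \<in> three; j \<in> three; i \<noteq> j; 3 dvd r - (x i - x j)\<rbrakk> \<Longrightarrow> short_root i j r \<in> coset_roots x"
  unfolding coset_roots_def by blast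

lemma coset_rootsE:
  assumes "v \<in> coset_roots x"
  obtains i j r where "i \<in> three" "j \<in> three" "i \<noteq> j" "3 dvd r - (x i - x j)" "v = short_root i j r"
  using assms unfolding coset_roots_def by blast

lemma coset_roots_subset: "coset_roots x \<subseteq> \<Phi>"
  by (auto elim!: coset_rootsE intro: short_mem_roots)

lemma coset_roots_nonempty: "coset_roots x \<noteq> {}"
  using coset_rootsI[of 1 2 "x 1 - x 2" x] by (auto simp: three_def)

lemma long_not_in_coset_roots: "a \<in> three \<Longrightarrow> long_root a r \<notin> coset_roots x"
  using norm_long[of a r] by (auto elim!: coset_rootsE simp: norm_short)

lemma coset_roots_proper: "coset_roots x \<noteq> \<Phi>"
  using long_mem_roots(1)[of 1 0] long_not_in_coset_roots[of 1 0 x] by (auto simp: three_def)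

abbreviation swap :: "nat \<Rightarrow> nat \<Rightarrow> nat \<Rightarrow> nat" where "swap \<equiv> Transposition.transpose"

lemma reflection_short_short:
  assumes "i \<in> three" "j \<in> three" "i \<noteq> j" "k \<in> three" "l \<in> three"
  shows "root_reflection B (short_root i j r) (short_root k l s) =
    short_root (swap i j k) (swap i j l)
      (s - (of_bool (i = k) - of_bool (i = l) - of_bool (j = k) + of_bool (j = l)) * r)"
proof -
  have c: "cartan_int B (short_root k l s) (short_root i j r) =
    of_bool (i = k) - of_bool (i = l) - of_bool (j = k) + of_bool (j = l)"
    using assms unfolding cartan_int_def symmetric_form[of "short_root k l s"]
    by (simp add: norm_short form_short_short)
  show ?thesis unfolding root_reflection_def c
    using assms by (auto simp: short_root_def Transposition.transpose_def algebra_simps scaleR_2)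
qed

lemma swap_mem_three:
  "\<lbrakk>i \<in> three; j \<in> three; k \<in> three\<rbrakk> \<Longrightarrow> swap i j k \<in> three"
  by (simp add: Transposition.transpose_def)

text \<open>
The reflection changes \<open>s\<close> and the difference \<open>x\<^sub>k - x\<^sub>l\<close> by the same multiple \<open>n\<close> of \<open>r\<close> and of
\<open>x\<^sub>i - x\<^sub>j\<close>, so the congruence survives.
\<close>

lemma coset_roots_subroot_system: "subroot_system B \<Phi> (coset_roots x)"
  unfolding subroot_system_def
proof (intro conjI ballI coset_roots_nonempty coset_roots_subset)
  fix \<alpha> \<beta> assume "\<alpha> \<in> coset_roots x" "\<beta> \<in> coset_roots x"
  then obtain i j r k l s where ij: "i \<in> three" "j \<in> three" "i \<noteq> j" "3 dvd r - (x i - x j)"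
    and kl: "k \<in> three" "l \<in> three" "k \<noteq> l" "3 dvd s - (x k - x l)"
    and ab: "\<alpha> = short_root i j r" "\<beta> = short_root k l s"
    by (elim coset_rootsE)
  define n :: int where
    "n = of_bool (i = k) - of_bool (i = l) - of_bool (j = k) + of_bool (j = l)"
  have "x (swap i j k) - x (swap i j l) = x k - x l - n * (x i - x j)"
    using ij(3) kl(3) by (auto simp: n_def Transposition.transpose_def)
  then have e: "s - n * r - (x (swap i j k) - x (swap i j l)) =
      (s - (x k - x l)) - n * (r - (x i - x j))"
    by (simp add: algebra_simps)
  have "3 dvd s - n * r - (x (swap i j k) - x (swap i j l))"
    unfolding e by (rule dvd_diff[OF kl(4) dvd_mult[OF ij(4)]])
  moreover have "swap i j k \<noteq> swap i j l"
    using kl(3) by (metis Transposition.transpose_involutory)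
  ultimately show "root_reflection B \<alpha> \<beta> \<in> coset_roots x"
    unfolding ab reflection_short_short[OF ij(1-3) kl(1,2)] n_def[symmetric]
    using ij kl by (intro coset_rootsI swap_mem_three)
qed

lemma norm_short_add_short:
  assumes "i \<in> three" "j \<in> three" "i \<noteq> j" "k \<in> three" "l \<in> three" "k \<noteq> l"
  shows "B (short_root i j r + short_root k l s) (short_root i j r + short_root k l s) =
    4 + 2 * (of_bool (i = k) - of_bool (i = l) - of_bool (j = k) + of_bool (j = l))"
  unfolding form_simps using assms by (simp add: form_short_short)

text \<open>
The norm of the sum depends only on the indices, and roots have norm 2 or 6. Norm 2 means that the
indices can be chained to a short root, norm 6 that the sum is a long root.
\<close>

lemma short_add_short_cases [consumes 7, case_names chain chain_rev out into]:
  assumes ij: "i \<in> three" "j \<in> three" "i \<noteq> j" and kl: "k \<in> three" "l \<in> three" "k \<noteq> l"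
    and sum: "short_root i j r + short_root k l s \<in> \<Phi>"
  obtains "j = k" "i \<noteq> l" | "i = l" "j \<noteq> k"
  | "i = k" "j \<noteq> l" "B (short_root i j r + short_root k l s) (short_root i j r + short_root k l s) = 6"
  | "j = l" "i \<noteq> k" "B (short_root i j r + short_root k l s) (short_root i j r + short_root k l s) = 6"
proof -
  let ?n = "of_bool (i = k) - of_bool (i = l) - of_bool (j = k) + of_bool (j = l) :: real"
  have "4 + 2 * ?n \<in> {2, 6}"
    unfolding norm_short_add_short[OF ij kl, of r s, symmetric] using sum
    by (cases rule: root_cases) (simp_all add: norm_short norm_long norm_long_neg)
  then show thesis using that ij(3) kl(3) norm_short_add_short[OF ij kl, of r s]
    by (auto simp: of_bool_def split: if_splits)
qed

text \<open>
The norm separates the long from the short roots, and the coefficient of \<open>\<delta>\<close> then decides.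
\<close>

lemma long_height_dvd:
  assumes i: "i \<in> three"
  shows "long_root i m \<in> \<Phi> \<longleftrightarrow> 3 dvd m" "- long_root i m \<in> \<Phi> \<longleftrightarrow> 3 dvd m"
proof -
  obtain c :: "'v \<Rightarrow> real" where c: "linear c" "c \<delta> = 1" "\<And>i. i \<in> three \<Longrightarrow> c (\<epsilon> i) = 0"
    using delta_coefficient by (auto simp: three_def)
  have cl: "c (long_root a r) = of_int r" if "a \<in> three" for a r
    using that c(2,3) unfolding long_root_def
    by (simp add: linear_add[OF c(1)] linear_diff[OF c(1)] linear_scale[OF c(1)] linear_sum[OF c(1)])
  have *: "3 dvd t" if "v \<in> \<Phi>" "B v v = 6" "c v = of_int t" for v t
    using that
  proof (cases rule: root_cases)
    case (long a r)
    then have "real_of_int t = real_of_int (3 * r)" using that cl by metis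
    then show ?thesis by (metis dvd_triv_left of_int_eq_iff)
  next
    case (neg_long a r)
    then have "real_of_int t = real_of_int (3 * (- r))" using that cl linear_neg[OF c(1)] by simp
    then show ?thesis by (metis dvd_triv_left of_int_eq_iff)
  qed (simp add: norm_short)
  show "long_root i m \<in> \<Phi> \<longleftrightarrow> 3 dvd m"
    using *[of "long_root i m" m] norm_long i cl long_mem_roots(1) by (auto elim!: dvdE)
  show "- long_root i m \<in> \<Phi> \<longleftrightarrow> 3 dvd m"
    using *[of "- long_root i m" "- m"] norm_long_neg i cl long_mem_roots(2) linear_neg[OF c(1)]
    by (auto elim!: dvdE)
qed

text \<open>
A sum that is short stays inside because the differences telescope. A sum that is long cannot
occur: its coefficient of \<open>\<delta>\<close> would be a multiple of 3 and yet, up to sign, congruent to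
\<open>x\<^sub>1 + x\<^sub>2 + x\<^sub>3\<close>.
\<close>

lemma coset_roots_closed:
  assumes S: "\<not> 3 dvd sum x three"
  shows "closed_subroot_system B \<Phi> (coset_roots x)"
  unfolding closed_subroot_system_def closed_in_roots_def
proof (intro conjI ballI impI coset_roots_subroot_system)
  fix \<alpha> \<beta> assume "\<alpha> \<in> coset_roots x" "\<beta> \<in> coset_roots x" and sum: "\<alpha> + \<beta> \<in> \<Phi>"
  then obtain i j r k l s where ij: "i \<in> three" "j \<in> three" "i \<noteq> j" "3 dvd r - (x i - x j)"
    and kl: "k \<in> three" "l \<in> three" "k \<noteq> l" "3 dvd s - (x k - x l)"
    and ab: "\<alpha> = short_root i j r" "\<beta> = short_root k l s"
    by (elim coset_rootsE)
  from ij(1-3) kl(1-3) sum[unfolded ab] show "\<alpha> + \<beta> \<in> coset_roots x"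
  proof (cases rule: short_add_short_cases)
    case chain
    have "3 dvd r + s - (x i - x l)" using dvd_add[OF ij(4) kl(4)] chain by (simp add: algebra_simps)
    then show ?thesis using ab chain ij kl by (simp add: short_add coset_rootsI)
  next
    case chain_rev
    have "3 dvd s + r - (x k - x j)" using dvd_add[OF ij(4) kl(4)] chain_rev by (simp add: algebra_simps)
    then show ?thesis using ab chain_rev ij kl
      by (metis add.commute short_add coset_rootsI)
  next
    case out
    have p: "{i,j,l} = three" using out ij kl by (intro permutation_threeI) auto
    have "3 dvd r + s"
      using sum unfolding ab out(1)[symmetric] short_add_out[OF p] long_height_dvd(1)[OF ij(1)] .
    then have False using ij(4) kl(4) S unfolding sum_three[OF p] out(1)[symmetric] by presburger
    then show ?thesis ..
  next
    case into
    have p: "{i,k,j} = three" using into ij kl by (intro permutation_threeI) auto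
    have "3 dvd - (r + s)"
      using sum unfolding ab into(1)[symmetric] short_add_in[OF p] long_height_dvd(2)[OF ij(2)] .
    then have False using ij(4) kl(4) S unfolding sum_three[OF p] into(1)[symmetric] by presburger
    then show ?thesis ..
  qed
qed

section \<open>Closed subroot systems without long roots\<close>

lemma reflection_self: "B v v \<noteq> 0 \<Longrightarrow> root_reflection B v v = - v"
  by (simp add: root_reflection_def cartan_int_def scaleR_2)

lemma norm_root_pos: "v \<in> \<Phi> \<Longrightarrow> B v v > 0"
  by (cases v rule: root_cases) (simp_all add: norm_short norm_long norm_long_neg)

lemma closed_subroot_neg:
  assumes "closed_subroot_system B \<Phi> \<Delta>" "v \<in> \<Delta>"
  shows "- v \<in> \<Delta>"
proof -
  have "v \<in> \<Phi>" "root_reflection B v v \<in> \<Delta>"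
    using assms unfolding closed_subroot_system_def subroot_system_def by auto
  then show ?thesis using reflection_self norm_root_pos[of v] by force
qed

lemma closed_subroot_add:
  assumes "closed_subroot_system B \<Phi> \<Delta>" "v \<in> \<Delta>" "w \<in> \<Delta>" "v + w \<in> \<Phi>"
  shows "v + w \<in> \<Delta>"
  using assms unfolding closed_subroot_system_def closed_in_roots_def by blast

lemma closed_subroot_short_neg:
  assumes "closed_subroot_system B \<Phi> \<Delta>" "short_root i j r \<in> \<Delta>"
  shows "short_root j i (- r) \<in> \<Delta>"
  using closed_subroot_neg[OF assms] by (simp add: short_neg)

lemma closed_subroot_short_add:
  assumes "closed_subroot_system B \<Phi> \<Delta>" "{i,j,k} = three"
    and "short_root i j r \<in> \<Delta>" "short_root j k s \<in> \<Delta>"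
  shows "short_root i k (r + s) \<in> \<Delta>"
  using closed_subroot_add[OF assms(1,3,4)] permutation_three[OF assms(2)]
  by (simp add: short_add short_mem_roots)

text \<open>
One sign suffices, since closed subroot systems are stable under negation.
\<close>

definition long_free :: "'v set \<Rightarrow> bool" where
  "long_free \<Delta> \<longleftrightarrow> (\<forall>a\<in>three. \<forall>r. long_root a (3 * r) \<notin> \<Delta>)"

lemma long_free_out:
  assumes cl: "closed_subroot_system B \<Phi> \<Delta>" and lf: "long_free \<Delta>" and p: "{i,j,k} = three"
    and "short_root i j r \<in> \<Delta>" "short_root i k s \<in> \<Delta>"
  shows "\<not> 3 dvd r + s"
proof
  assume "3 dvd r + s"
  then obtain t where t: "r + s = 3 * t" ..
  have i: "i \<in> three" using permutation_three[OF p] by simp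
  have "long_root i (3 * t) \<in> \<Delta>"
    using closed_subroot_add[OF cl assms(4,5)] long_mem_roots(1)[OF i]
    unfolding short_add_out[OF p] t by blast
  then show False using lf i unfolding long_free_def by blast
qed

text \<open>
If \<open>r\<close> and \<open>s\<close> both occur for \<open>(i,j)\<close>, then \<open>t\<close>, \<open>t + (r - s)\<close> and \<open>t - (r - s)\<close> occur for \<open>(j,k)\<close>.
Each such \<open>t'\<close> gives \<open>r + t'\<close> for \<open>(i,k)\<close>, and since no long root is available, \<open>2r + t'\<close> is not divisible
by 3. If \<open>r - s\<close> were not divisible by 3, the three values of \<open>t'\<close> would cover all residues.
\<close>

lemma long_free_residue_unique:
  assumes cl: "closed_subroot_system B \<Phi> \<Delta>" and lf: "long_free \<Delta>" and p: "{i,j,k} = three"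
    and r: "short_root i j r \<in> \<Delta>" and s: "short_root i j s \<in> \<Delta>" and t: "short_root j k t \<in> \<Delta>"
  shows "3 dvd r - s"
proof -
  have p': "{j,i,k} = three" using p by blast
  have shift: "short_root j k (t' + (a - b)) \<in> \<Delta>"
    if "short_root i j a \<in> \<Delta>" "short_root i j b \<in> \<Delta>" "short_root j k t' \<in> \<Delta>" for a b t'
  proof -
    have "short_root i k (a + t') \<in> \<Delta>" by (rule closed_subroot_short_add[OF cl p that(1,3)])
    from closed_subroot_short_add[OF cl p' closed_subroot_short_neg[OF cl that(2)] this]
    show ?thesis by (simp add: algebra_simps)
  qed
  have avoid: "\<not> 3 dvd r + (r + t')" if "short_root j k t' \<in> \<Delta>" for t'
    by (rule long_free_out[OF cl lf p r closed_subroot_short_add[OF cl p r that]])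
  have "\<not> 3 dvd r + (r + t)" "\<not> 3 dvd r + (r + (t + (r - s)))" "\<not> 3 dvd r + (r + (t + (s - r)))"
    using avoid shift r s t by blast+
  then show ?thesis by presburger
qed

lemma long_free_subset_coset_roots:
  assumes cl: "closed_subroot_system B \<Phi> \<Delta>" and lf: "long_free \<Delta>"
    and x: "\<And>i j. \<lbrakk>i \<in> three; j \<in> three; i \<noteq> j\<rbrakk> \<Longrightarrow> short_root i j (x i - x j) \<in> \<Delta>"
  shows "\<Delta> \<subseteq> coset_roots x"
proof
  fix v assume v: "v \<in> \<Delta>"
  then have "v \<in> \<Phi>" using cl unfolding closed_subroot_system_def subroot_system_def by blast
  then show "v \<in> coset_roots x"
  proof (cases rule: root_cases)
    case (short i j r)
    obtain k where p: "{i,j,k} = three" using third_index short by metis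
    note q = permutation_three[OF p]
    from long_free_residue_unique[OF cl lf p v[unfolded short(4)] x[OF q(1,2,4)] x[OF q(2,3,6)]]
    show ?thesis unfolding short(4) using short by (intro coset_rootsI)
  next
    case (long a r)
    then show ?thesis using v lf by (simp add: long_free_def)
  next
    case (neg_long a r)
    then show ?thesis using closed_subroot_neg[OF cl v] lf by (simp add: long_free_def)
  qed
qed

text \<open>
Normalise \<open>x\<^sub>3 = 0\<close> and take for \<open>x\<^sub>1\<close> and \<open>x\<^sub>2\<close> integers that occur for \<open>(1,3)\<close> and \<open>(2,3)\<close>. Their sum is
the coefficient of \<open>\<delta>\<close> in a sum of two short roots at an angle of 60 degrees, hence not divisible by 3.
\<close>

lemma long_free_closed_subset_coset_roots:
  assumes cl: "closed_subroot_system B \<Phi> \<Delta>" and lf: "long_free \<Delta>"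
    and full: "\<And>i j. \<lbrakk>i \<in> three; j \<in> three; i \<noteq> j\<rbrakk> \<Longrightarrow> \<exists>r. short_root i j r \<in> \<Delta>"
  obtains x where "\<not> 3 dvd sum x three" "\<Delta> \<subseteq> coset_roots x"
proof -
  have perm: "{1,2,3} = three" "{3,1,2} = three" by (auto simp: three_def)
  note q = permutation_three[OF perm(1)]
  obtain p where p: "short_root 1 3 p \<in> \<Delta>" using full q by blast
  obtain q' where q': "short_root 2 3 q' \<in> \<Delta>" using full q by blast
  define x :: "nat \<Rightarrow> int" where "x = (\<lambda>_. 0)(1 := p, 2 := q')"
  note neg = closed_subroot_short_neg[OF cl]
  have d: "short_root 1 2 (p - q') \<in> \<Delta>"
    using closed_subroot_short_add[OF cl _ p neg[OF q']] perm by (simp add: insert_commute)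
  have "short_root i j (x i - x j) \<in> \<Delta>" if "i \<in> three" "j \<in> three" "i \<noteq> j" for i j
    using that p q' d neg[OF p] neg[OF q'] neg[OF d] by (auto simp: x_def three_def)
  from long_free_subset_coset_roots[OF cl lf this] have "\<Delta> \<subseteq> coset_roots x" .
  moreover have "\<not> 3 dvd sum x three"
    using long_free_out[OF cl lf perm(2) neg[OF p] neg[OF q']] by (simp add: x_def three_def) presburger
  ultimately show thesis using that by blast
qed

section \<open>Maximality\<close>

text \<open>
Let \<open>d = x\<^sub>1 + x\<^sub>2 + x\<^sub>3\<close>. Adding a long root \<open>3\<epsilon>\<^sub>i - (\<epsilon>\<^sub>1 + \<epsilon>\<^sub>2 + \<epsilon>\<^sub>3) + 3m\<delta>\<close> to the roots
\<open>\<epsilon>\<^sub>j - \<epsilon>\<^sub>i + s\<delta>\<close> of \<open>coset_roots x\<close> produces roots \<open>\<epsilon>\<^sub>i - \<epsilon>\<^sub>k + r\<delta>\<close> with \<open>r \<equiv> x\<^sub>j - x\<^sub>i \<equiv> x\<^sub>i - x\<^sub>k + d\<close>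
modulo 3. Further sums carry the shift \<open>d\<close> to all pairs of indices, and doubling it supplies the
remaining residue class.
\<close>

lemma closed_with_long_is_all:
  assumes cl: "closed_subroot_system B \<Phi> \<Delta>" and S: "\<not> 3 dvd sum x three"
    and sub: "coset_roots x \<subseteq> \<Delta>" and i: "i \<in> three" and long: "long_root i (3 * m) \<in> \<Delta>"
  shows "\<Delta> = \<Phi>"
proof -
  define shifted where "shifted d i j \<longleftrightarrow> (\<forall>r. 3 dvd r - (x i - x j + d) \<longrightarrow> short_root i j r \<in> \<Delta>)"
    for d i j
  \<comment> \<open>Shifts add up along a chain of indices; an unshifted pair on either side transports a shift.\<close>
  have base: "shifted 0 i j" if "i \<in> three" "j \<in> three" "i \<noteq> j" for i j
    using that sub unfolding shifted_def by (auto intro: coset_rootsI)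
  have add: "shifted (d + e) i k" if p: "{i,j,k} = three" and "shifted d i j" "shifted e j k" for d e i j k
    unfolding shifted_def
  proof (intro allI impI)
    fix r assume r: "3 dvd r - (x i - x k + (d + e))"
    \<comment> \<open>The second summand may be any fixed member of its class; the first absorbs the rest.\<close>
    have "short_root i j (r - (x j - x k + e)) \<in> \<Delta>"
      using that(2) r unfolding shifted_def by (simp add: algebra_simps)
    moreover have "short_root j k (x j - x k + e) \<in> \<Delta>"
      using that(3) unfolding shifted_def by simp
    ultimately show "short_root i k r \<in> \<Delta>"
      using closed_subroot_short_add[OF cl p] by force
  qed
  have right: "shifted d i k" if p: "{i,j,k} = three" and "shifted d i j" for d i j k
    using add[OF p that(2) base] permutation_three[OF p] by simp
  have left: "shifted d i k" if p: "{i,j,k} = three" and "shifted d j k" for d i j k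
    using add[OF p base that(2)] permutation_three[OF p] by simp
  obtain j k where p: "{i,j,k} = three" using other_indices[OF i] .
  note q = permutation_three[OF p]
  let ?d = "sum x three"
  have sx: "?d = x i + x j + x k" by (rule sum_three[OF p])
  have first: "shifted ?d i k"
    unfolding shifted_def
  proof (intro allI impI)
    fix r assume r: "3 dvd r - (x i - x k + ?d)"
    have "3 dvd (r - 3 * m) - (x j - x i)"
      using r unfolding sx by presburger
    then have "short_root j i (r - 3 * m) \<in> \<Delta>"
      using sub q by (auto intro: coset_rootsI)
    from closed_subroot_add[OF cl long this] show "short_root i k r \<in> \<Delta>"
      unfolding long_add_short[OF p] using q by (simp add: short_mem_roots)
  qed
  have perms: "{i,k,j} = three" "{j,i,k} = three" "{j,k,i} = three" "{k,i,j} = three" "{k,j,i} = three"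
    using p by auto
  have ij: "shifted ?d i j" by (rule right[OF perms(1) first])
  have jk: "shifted ?d j k" by (rule left[OF perms(2) first])
  have kj: "shifted ?d k j" by (rule left[OF perms(4) ij])
  have ji: "shifted ?d j i" by (rule right[OF perms(3) jk])
  have ki: "shifted ?d k i" by (rule right[OF perms(5) kj])
  have all1: "shifted ?d a b" if "a \<in> three" "b \<in> three" "a \<noteq> b" for a b
    using that ij jk kj ji ki first unfolding p[symmetric] by auto
  have all2: "shifted (?d + ?d) a b" if ab: "a \<in> three" "b \<in> three" "a \<noteq> b" for a b
  proof -
    obtain c where "{a,b,c} = three" using third_index ab by metis
    then have "{a,c,b} = three" by (simp add: insert_commute)
    note c = this permutation_three[OF this]
    show ?thesis by (rule add[OF c(1) all1 all1]) (use c in auto)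
  qed
  have short: "short_root a b r \<in> \<Delta>" if ab: "a \<in> three" "b \<in> three" "a \<noteq> b" for a b r
  proof -
    have "3 dvd r - (x a - x b + 0) \<or> 3 dvd r - (x a - x b + ?d) \<or> 3 dvd r - (x a - x b + (?d + ?d))"
      using S by presburger
    then show ?thesis using base[OF ab] all1[OF ab] all2[OF ab] unfolding shifted_def by blast
  qed
  have "long_root a (3 * r) \<in> \<Delta>" if a: "a \<in> three" for a r
  proof -
    obtain b c where p: "{a,b,c} = three" using other_indices[OF a] .
    note q = permutation_three[OF p]
    have "long_root a (3 * r) = short_root a b 0 + short_root a c (3 * r)"
      by (simp add: short_add_out[OF p])
    then show ?thesis
      using closed_subroot_add[OF cl short[OF q(1,2,4), of 0] short[OF q(1,3,5), of "3 * r"]]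
        long_mem_roots(1)[OF a, of r] by metis
  qed
  then have "v \<in> \<Delta>" if "v \<in> \<Phi>" for v
    using root_cases[OF that] short closed_subroot_neg[OF cl] by metis
  moreover have "\<Delta> \<subseteq> \<Phi>" using cl unfolding closed_subroot_system_def subroot_system_def by blast
  ultimately show ?thesis by blast
qed

lemma coset_roots_maximal:
  assumes S: "\<not> 3 dvd sum x three"
  shows "maximal_closed_subroot_system B \<Phi> (coset_roots x)"
  unfolding maximal_closed_subroot_system_def
proof (intro conjI allI impI coset_roots_closed[OF S] coset_roots_proper)
  fix \<Delta> assume \<Delta>: "closed_subroot_system B \<Phi> \<Delta> \<and> coset_roots x \<subseteq> \<Delta> \<and> \<Delta> \<subset> \<Phi>"
  then have lf: "long_free \<Delta>"
    using closed_with_long_is_all[OF _ S] unfolding long_free_def by blast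
  have "short_root i j (x i - x j) \<in> \<Delta>" if "i \<in> three" "j \<in> three" "i \<noteq> j" for i j
    using \<Delta> coset_rootsI[OF that, of "x i - x j" x] by auto
  from long_free_subset_coset_roots[OF _ lf this] \<Delta> have "\<Delta> \<subseteq> coset_roots x" by blast
  with \<Delta> show "\<Delta> = coset_roots x" by blast
qed

section \<open>Semi-closed gradients\<close>

lemma G2_roots_subset: "G2_roots \<epsilon> \<subseteq> \<Phi>"
  using long_mem_roots[of _ 0] by (auto simp: G2_roots_def G2_short_eq G2_long_eq short_mem_roots)

lemma norm_G2_short: "v \<in> G2_short \<epsilon> \<Longrightarrow> B v v = 2"
  by (auto simp: G2_short_eq norm_short)

lemma norm_G2_long: "v \<in> G2_long \<epsilon> \<Longrightarrow> B v v = 6"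
  by (auto simp: G2_long_eq norm_long norm_long_neg)

lemma reflection_short_long:
  assumes "a \<in> three" "b \<in> three" "a \<noteq> b"
  shows "root_reflection B (short_root a b 0) (long_root a 0) = long_root b 0"
proof -
  have "cartan_int B (long_root a 0) (short_root a b 0) = 3"
    using assms by (simp add: cartan_int_def norm_short form_long_short)
  then show ?thesis
    by (simp add: root_reflection_def short_root_def long_root_def algebra_simps)
qed

text \<open>
Failure of closedness yields two short roots in \<open>G\<close> with a long sum outside \<open>G\<close>. After a change of sign
they are \<open>\<epsilon>\<^sub>a - \<epsilon>\<^sub>b\<close> and \<open>\<epsilon>\<^sub>a - \<epsilon>\<^sub>c\<close>, and one reflection gives \<open>\<epsilon>\<^sub>b - \<epsilon>\<^sub>c\<close>, hence all short roots. Their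
reflections permute the three long roots \<open>long_root a 0\<close>, so a long root in \<open>G\<close> would force all of
them into \<open>G\<close>, including the missing sum.
\<close>

lemma semi_closed_eq_short:
  assumes "semi_closed B \<epsilon> G"
  shows "G = G2_short \<epsilon>"
proof -
  have GG: "G \<subseteq> G2_roots \<epsilon>" and refl: "\<And>v w. \<lbrakk>v \<in> G; w \<in> G\<rbrakk> \<Longrightarrow> root_reflection B v w \<in> G"
    using assms unfolding semi_closed_def subroot_system_def by blast+
  have neg: "- v \<in> G" if "v \<in> G" for v
    using refl[OF that that] that GG G2_roots_subset norm_root_pos[of v] reflection_self[of v] by force
  obtain \<alpha> \<beta> where ab: "\<alpha> \<in> G" "\<beta> \<in> G" "\<alpha> + \<beta> \<in> G2_roots \<epsilon>" "\<alpha> + \<beta> \<notin> G"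
    using assms unfolding semi_closed_def closed_in_roots_def by blast
  then have sh: "\<alpha> \<in> G2_short \<epsilon>" "\<beta> \<in> G2_short \<epsilon>" "\<alpha> + \<beta> \<in> G2_long \<epsilon>"
    using assms unfolding semi_closed_def by blast+
  obtain i j where ij: "i \<in> three" "j \<in> three" "i \<noteq> j" "\<alpha> = short_root i j 0"
    using sh(1) unfolding G2_short_eq by blast
  obtain k l where kl: "k \<in> three" "l \<in> three" "k \<noteq> l" "\<beta> = short_root k l 0"
    using sh(2) unfolding G2_short_eq by blast
  have norm: "B (\<alpha> + \<beta>) (\<alpha> + \<beta>) = 6" by (rule norm_G2_long[OF sh(3)])
  have "\<exists>a b c. {a,b,c} = three \<and> short_root a b 0 \<in> G \<and> short_root a c 0 \<in> G"
  proof -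
    have sum: "short_root i j 0 + short_root k l 0 \<in> \<Phi>"
      using ab(3) G2_roots_subset unfolding ij(4) kl(4) by blast
    from ij(1-3) kl(1-3) sum show ?thesis
    proof (cases rule: short_add_short_cases)
      case chain
      then show ?thesis using norm ij kl by (simp add: short_add norm_short)
    next
      case chain_rev
      then show ?thesis using norm ij kl
        by (simp add: add.commute[of "short_root l j 0"] short_add norm_short)
    next
      case out
      have "{i,j,l} = three" by (rule permutation_threeI) (use out ij kl in auto)
      then show ?thesis using ab(1,2) unfolding ij(4) kl(4) out(1) by blast
    next
      case into
      have "{j,i,k} = three" by (rule permutation_threeI) (use into ij kl in auto)
      moreover have "short_root j i 0 \<in> G" "short_root j k 0 \<in> G"
        using neg[OF ab(1)] neg[OF ab(2)] unfolding ij(4) kl(4) short_neg into(1) by simp_all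
      ultimately show ?thesis by blast
    qed
  qed
  then obtain a b c where p: "{a,b,c} = three" and s: "short_root a b 0 \<in> G" "short_root a c 0 \<in> G"
    by blast
  note q = permutation_three[OF p]
  have "short_root b c 0 \<in> G"
    using refl[OF s] q by (simp add: reflection_short_short Transposition.transpose_def)
  with s have "short_root u v 0 \<in> G" if "u \<in> three" "v \<in> three" "u \<noteq> v" for u v
    using that neg[OF s(1)] neg[OF s(2)] neg[OF \<open>short_root b c 0 \<in> G\<close>]
    unfolding p[symmetric] short_neg by auto
  then have short: "G2_short \<epsilon> \<subseteq> G" unfolding G2_short_eq by blast
  have "G2_long \<epsilon> \<inter> G = {}"
  proof (rule ccontr)
    assume "G2_long \<epsilon> \<inter> G \<noteq> {}"
    then obtain e where e: "e \<in> three" "long_root e 0 \<in> G"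
      using neg unfolding G2_long_eq by force
    have "long_root d 0 \<in> G" if d: "d \<in> three" for d
    proof (cases "d = e")
      case False
      have "short_root e d 0 \<in> G" using short d e(1) False unfolding G2_short_eq by blast
      from refl[OF this e(2)] show ?thesis using d e(1) False by (simp add: reflection_short_long)
    qed (use e in simp)
    then have "G2_long \<epsilon> \<subseteq> G" using neg unfolding G2_long_eq by blast
    then show False using sh(3) ab(4) by blast
  qed
  then show ?thesis using GG short unfolding G2_roots_def by blast
qed

lemma G2_short_semi_closed: "semi_closed B \<epsilon> (G2_short \<epsilon>)"
  unfolding semi_closed_def
proof (intro conjI ballI impI)
  have perm: "{1,2,3} = three" by (simp add: three_def)
  note q = permutation_three[OF perm]
  show "subroot_system B (G2_roots \<epsilon>) (G2_short \<epsilon>)"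
    unfolding subroot_system_def
  proof (intro conjI ballI)
    show "G2_short \<epsilon> \<noteq> {}" using q unfolding G2_short_eq by blast
    show "G2_short \<epsilon> \<subseteq> G2_roots \<epsilon>" by (simp add: G2_roots_def)
    fix \<alpha> \<beta> assume "\<alpha> \<in> G2_short \<epsilon>" "\<beta> \<in> G2_short \<epsilon>"
    then obtain i j k l where ij: "i \<in> three" "j \<in> three" "i \<noteq> j" "\<alpha> = short_root i j 0"
      and kl: "k \<in> three" "l \<in> three" "k \<noteq> l" "\<beta> = short_root k l 0"
      unfolding G2_short_eq by blast
    have "swap i j k \<noteq> swap i j l" using kl(3) by (metis Transposition.transpose_involutory)
    moreover have "swap i j k \<in> three" by (rule swap_mem_three[OF ij(1,2) kl(1)])
    moreover have "swap i j l \<in> three" by (rule swap_mem_three[OF ij(1,2) kl(2)])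
    ultimately show "root_reflection B \<alpha> \<beta> \<in> G2_short \<epsilon>"
      unfolding ij(4) kl(4) reflection_short_short[OF ij(1-3) kl(1,2)] G2_short_eq
      by (simp only: mult_zero_right diff_zero) blast
  qed
  \<comment> \<open>A witness that the short roots are not closed.\<close>
  have "short_root 1 2 0 + short_root 1 3 0 = long_root 1 0"
    using short_add_out[OF perm, of 0 0] by simp
  moreover have "long_root 1 0 \<in> G2_long \<epsilon>" using q unfolding G2_long_eq by blast
  moreover have "long_root 1 0 \<notin> G2_short \<epsilon>"
    using norm_G2_short[of "long_root 1 0"] norm_long[OF q(1), of 0] by auto
  moreover have "short_root 1 2 0 \<in> G2_short \<epsilon>" "short_root 1 3 0 \<in> G2_short \<epsilon>"
    using q unfolding G2_short_eq by blast+
  ultimately show "\<not> closed_in_roots (G2_roots \<epsilon>) (G2_short \<epsilon>)"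
    unfolding closed_in_roots_def G2_roots_def by (metis UnI2)
qed (auto simp: G2_roots_def)

lemma G2_short_proper: "G2_short \<epsilon> \<noteq> G2_roots \<epsilon>"
proof -
  have "1 \<in> three" by (simp add: three_def)
  then have "long_root 1 0 \<in> G2_roots \<epsilon>" "long_root 1 0 \<notin> G2_short \<epsilon>"
    using norm_G2_short[of "long_root 1 0"] norm_long[of 1 0]
    by (auto simp: G2_roots_def G2_long_eq)
  then show ?thesis by blast
qed

lemma long_free_of_short_gradient:
  assumes "gradient \<epsilon> \<delta> \<Psi> = G2_short \<epsilon>"
  shows "long_free \<Psi>"
  unfolding long_free_def
proof (intro ballI allI notI)
  fix a r assume a: "a \<in> three" and "long_root a (3 * r) \<in> \<Psi>"
  then have "long_root a 0 + of_int (3 * r) *\<^sub>R \<delta> \<in> \<Psi>" using long_eq_finite_plus(1) by metis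
  then have "long_root a 0 \<in> gradient \<epsilon> \<delta> \<Psi>"
    using a unfolding gradient_def G2_roots_def G2_long_eq by blast
  then show False using norm_G2_short norm_long[OF a, of 0] unfolding assms by fastforce
qed

lemma maximal_with_short_gradient:
  assumes max: "maximal_closed_subroot_system B \<Phi> \<Psi>" and gr: "gradient \<epsilon> \<delta> \<Psi> = G2_short \<epsilon>"
  obtains x where "\<not> 3 dvd sum x three" "\<Psi> = coset_roots x"
proof -
  have cl: "closed_subroot_system B \<Phi> \<Psi>"
    using max unfolding maximal_closed_subroot_system_def by blast
  have full: "\<exists>r. short_root i j r \<in> \<Psi>" if "i \<in> three" "j \<in> three" "i \<noteq> j" for i j
    using gradient_iff_short[OF that, of \<Psi>] that unfolding gr G2_short_eq by blast
  obtain x where x: "\<not> 3 dvd sum x three" "\<Psi> \<subseteq> coset_roots x"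
    using long_free_closed_subset_coset_roots[OF cl long_free_of_short_gradient[OF gr] full] by blast
  then have "\<Psi> = coset_roots x"
    using max coset_roots_closed[OF x(1)] coset_roots_proper[of x] coset_roots_subset[of x]
    unfolding maximal_closed_subroot_system_def by blast
  with x(1) show thesis using that by blast
qed

section \<open>The sets of the classification\<close>

text \<open>
The constant \<open>c\<close> cancels in the differences of the entries of \<open>x\<close>.
\<close>

lemma coset_roots_cong:
  assumes "\<And>a. a \<in> three \<Longrightarrow> 3 dvd x a - y a - c"
  shows "coset_roots x = coset_roots y"
proof -
  have "3 dvd r - (x i - x j) \<longleftrightarrow> 3 dvd r - (y i - y j)" if "i \<in> three" "j \<in> three" for i j r
    using assms[OF that(1)] assms[OF that(2)] by presburger
  then show ?thesis unfolding coset_roots_def by blast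
qed

lemma Psi_plus_eq: "Psi_plus \<epsilon> \<delta> i j k l =
    (\<Union>r. {short_root i j (3 * r), short_root j k (3 * r + l), short_root i k (3 * r + l)})"
  by (simp add: Psi_plus_def short_root_def)

lemma Psi_roots_eq_coset_roots:
  assumes p: "{i,j,k} = three"
  shows "Psi_roots \<epsilon> \<delta> i j k l = coset_roots (\<lambda>a. if a = k then 0 else l)" (is "_ = coset_roots ?x")
proof
  note q = permutation_three[OF p]
  show "Psi_roots \<epsilon> \<delta> i j k l \<subseteq> coset_roots ?x"
    unfolding Psi_roots_def Psi_plus_eq
    using q by (auto simp: short_neg intro!: coset_rootsI)
  have plus: "short_root i j r \<in> Psi_plus \<epsilon> \<delta> i j k l" if "3 dvd r" for r
    using that unfolding Psi_plus_eq by (auto elim!: dvdE)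
  have plus': "short_root j k r \<in> Psi_plus \<epsilon> \<delta> i j k l \<and> short_root i k r \<in> Psi_plus \<epsilon> \<delta> i j k l"
    if "3 dvd r - l" for r
  proof -
    from that obtain m where "r - l = 3 * m" ..
    then have "r = 3 * m + l" by simp
    then show ?thesis unfolding Psi_plus_eq by auto
  qed
  have minus: "short_root b a r \<in> Psi_roots \<epsilon> \<delta> i j k l"
    if "short_root a b (- r) \<in> Psi_plus \<epsilon> \<delta> i j k l" for a b r
    using imageI[OF that, of uminus] unfolding Psi_roots_def short_neg by simp
  have plus_sub: "Psi_plus \<epsilon> \<delta> i j k l \<subseteq> Psi_roots \<epsilon> \<delta> i j k l" by (simp add: Psi_roots_def)
  show "coset_roots ?x \<subseteq> Psi_roots \<epsilon> \<delta> i j k l"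
  proof
    fix v assume "v \<in> coset_roots ?x"
    then obtain a b r where ab: "a \<in> three" "b \<in> three" "a \<noteq> b" "3 dvd r - (?x a - ?x b)"
      and v: "v = short_root a b r" by (elim coset_rootsE)
    from ab(1-3) consider "a = i" "b = j" | "a = j" "b = k" | "a = i" "b = k"
      | "b = i" "a = j" | "b = j" "a = k" | "b = i" "a = k"
      unfolding p[symmetric] by auto
    then show "v \<in> Psi_roots \<epsilon> \<delta> i j k l"
    proof cases
      case 1
      then show ?thesis using plus[of r] plus_sub v ab q by auto
    next
      case 2
      then show ?thesis using plus'[of r] plus_sub v ab q by auto
    next
      case 3
      then show ?thesis using plus'[of r] plus_sub v ab q by auto
    next
      case 4
      have "3 dvd - r" using ab(4) 4 q by simp
      then show ?thesis unfolding v 4 by (intro minus plus)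
    next
      case 5
      have "3 dvd - r - l" using ab(4) 5 q by simp presburger
      then show ?thesis unfolding v 5 using plus' by (intro minus) blast
    next
      case 6
      have "3 dvd - r - l" using ab(4) 6 q by simp presburger
      then show ?thesis unfolding v 6 using plus' by (intro minus) blast
    qed
  qed
qed

text \<open>
Were the three entries of \<open>x\<close> pairwise incongruent modulo 3, their sum would be congruent to
\<open>0 + 1 + 2\<close>, which 3 divides. So two of them agree, say at \<open>i\<close> and \<open>j\<close>; subtracting \<open>x\<^sub>k\<close> brings \<open>x\<close> to the form
\<open>(l,l,0)\<close> modulo 3.
\<close>

lemma coset_roots_is_Psi_roots:
  assumes S: "\<not> 3 dvd sum x three"
  obtains i j k l where "{i,j,k} = three" "\<not> 3 dvd l" "coset_roots x = Psi_roots \<epsilon> \<delta> i j k l"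
proof -
  have p: "{1,2,3} = three" "{2,3,1} = three" "{1,3,2} = three" by (auto simp: three_def)
  have "3 dvd x 1 - x 2 \<or> 3 dvd x 2 - x 3 \<or> 3 dvd x 1 - x 3"
    using S unfolding sum_three[OF p(1)] by presburger
  then obtain i j k where ijk: "{i,j,k} = three" and e: "3 dvd x i - x j"
    using p by metis
  let ?l = "x i - x k"
  have "coset_roots x = coset_roots (\<lambda>a. if a = k then 0 else ?l)"
  proof (rule coset_roots_cong[where c = "x k"])
    fix a assume "a \<in> three"
    then show "3 dvd x a - (if a = k then 0 else ?l) - x k"
      using e unfolding ijk[symmetric] by (auto simp: dvd_diff_commute)
  qed
  then have eq: "coset_roots x = Psi_roots \<epsilon> \<delta> i j k ?l"
    unfolding Psi_roots_eq_coset_roots[OF ijk] .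
  have "\<not> 3 dvd ?l" using S e unfolding sum_three[OF ijk] by presburger
  from that[OF ijk this eq] show thesis .
qed

section \<open>The type\<close>

text \<open>
With only three indices two short roots cannot have disjoint index pairs, and any common index keeps
the form away from zero. Irreducibility follows at once.
\<close>

lemma form_short_short_nonzero:
  assumes "i \<in> three" "j \<in> three" "i \<noteq> j" "k \<in> three" "l \<in> three" "k \<noteq> l"
  shows "B (short_root i j r) (short_root k l s) \<noteq> 0"
  using assms by (auto simp: form_short_short three_def)

lemma coset_roots_irreducible: "irreducible_roots B (coset_roots x)"
  unfolding irreducible_roots_def
proof (intro conjI coset_roots_nonempty notI, elim exE conjE)
  fix P Q assume "P \<noteq> {}" "Q \<noteq> {}" "P \<union> Q = coset_roots x" and orth: "\<forall>\<alpha>\<in>P. \<forall>\<beta>\<in>Q. B \<alpha> \<beta> = 0"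
  then obtain \<alpha> \<beta> where "\<alpha> \<in> P" "\<beta> \<in> Q" "\<alpha> \<in> coset_roots x" "\<beta> \<in> coset_roots x" by blast
  then show False using orth by (elim coset_rootsE) (metis form_short_short_nonzero)
qed

lemma A2_1_eq: "A2_1_real_roots \<epsilon> \<delta> = {short_root i j r | i j r. i \<in> three \<and> j \<in> three \<and> i \<noteq> j}"
  unfolding A2_1_real_roots_def A2_roots_def short_root_def three_def by blast

text \<open>
The isomorphism is \<open>v \<mapsto> v - g(v)\<delta>\<close> with \<open>g\<close> chosen such that \<open>\<epsilon>\<^sub>i - \<epsilon>\<^sub>j + r\<delta>\<close> goes to
\<open>\<epsilon>\<^sub>i - \<epsilon>\<^sub>j + ((r - (x\<^sub>i - x\<^sub>j))/3)\<delta>\<close>: the functional \<open>c\<close> returns \<open>r\<close>, and the sum returns \<open>x\<^sub>i - x\<^sub>j\<close>. As \<open>\<delta>\<close>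
lies in the radical, the form is preserved; as \<open>g(\<delta>) = 2/3\<close> differs from 1, the map is injective.
\<close>

lemma coset_roots_isomorphic: "root_isomorphic B (coset_roots x) B (A2_1_real_roots \<epsilon> \<delta>)"
proof -
  obtain c :: "'v \<Rightarrow> real" where c: "linear c" "c \<delta> = 1" "\<And>i. i \<in> three \<Longrightarrow> c (\<epsilon> i) = 0"
    using delta_coefficient by (auto simp: three_def)
  define g where "g v = (2 * c v + (\<Sum>a\<in>three. of_int (x a) * B v (\<epsilon> a))) / 3" for v
  define f where "f v = v - g v *\<^sub>R \<delta>" for v
  have g: "linear g"
    by (rule linearI) (simp_all add: g_def linear_add[OF c(1)] linear_scale[OF c(1)] form_simps
        three_def algebra_simps add_divide_distrib)
  have f: "linear f"
    by (rule linearI) (simp_all add: f_def linear_add[OF g] linear_scale[OF g] algebra_simps)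
  have inj: "inj f"
    unfolding linear_injective_0[OF f]
  proof (intro allI impI)
    fix v assume "f v = 0"
    then have v: "v = g v *\<^sub>R \<delta>" by (simp add: f_def)
    have "g \<delta> = 2 / 3" by (simp add: g_def c(2) null_delta)
    then have "g v = g v * (2 / 3)" using arg_cong[OF v, of g] by (simp add: linear_scale[OF g])
    then show "v = 0" using v by simp
  qed
  have g_short: "g (short_root i j r) = of_int (2 * r + x i - x j) / 3"
    if "i \<in> three" "j \<in> three" for i j r
  proof -
    have "(\<Sum>a\<in>three. of_int (x a) * B (short_root i j r) (\<epsilon> a)) = real_of_int (x i - x j)"
      using that unfolding short_root_def form_simps null_delta
      by (auto simp: three_def orthonormal_eps)
    moreover have "c (short_root i j r) = of_int r"
      using that by (simp add: short_root_def linear_add[OF c(1)] linear_diff[OF c(1)]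
          linear_scale[OF c(1)] c(2,3))
    ultimately show ?thesis by (simp add: g_def)
  qed
  have f_short: "f (short_root i j (x i - x j + 3 * m)) = short_root i j m"
    if "i \<in> three" "j \<in> three" for i j m
  proof -
    have "f (short_root i j (x i - x j + 3 * m)) = \<epsilon> i - \<epsilon> j +
        (of_int (x i - x j + 3 * m) - g (short_root i j (x i - x j + 3 * m))) *\<^sub>R \<delta>"
      by (simp add: f_def short_root_def algebra_simps)
    also have "of_int (x i - x j + 3 * m) - g (short_root i j (x i - x j + 3 * m)) = of_int m"
      unfolding g_short[OF that] by (simp add: field_simps)
    finally show ?thesis by (simp add: short_root_def)
  qed
  have image: "f ` coset_roots x = A2_1_real_roots \<epsilon> \<delta>"
  proof
    show "f ` coset_roots x \<subseteq> A2_1_real_roots \<epsilon> \<delta>"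
    proof (intro image_subsetI, elim coset_rootsE)
      fix v i j r assume ij: "i \<in> three" "j \<in> three" "i \<noteq> j" "3 dvd r - (x i - x j)"
        and v: "v = short_root i j r"
      from ij(4) obtain m where "r - (x i - x j) = 3 * m" ..
      then have "r = x i - x j + 3 * m" by simp
      then have "f v = short_root i j m" using f_short ij v by blast
      then show "f v \<in> A2_1_real_roots \<epsilon> \<delta>" using ij unfolding A2_1_eq by blast
    qed
    show "A2_1_real_roots \<epsilon> \<delta> \<subseteq> f ` coset_roots x"
    proof
      fix w assume "w \<in> A2_1_real_roots \<epsilon> \<delta>"
      then obtain i j m where ij: "i \<in> three" "j \<in> three" "i \<noteq> j" and w: "w = short_root i j m"
        unfolding A2_1_eq by blast
      have "short_root i j (x i - x j + 3 * m) \<in> coset_roots x"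
        using ij by (intro coset_rootsI) auto
      then show "w \<in> f ` coset_roots x" using f_short[OF ij(1,2), of m] w by (metis imageI)
    qed
  qed
  have form: "B (f v) (f w) = B v w" for v w
    by (simp add: f_def form_simps null_delta form_delta_right)
  have "bij_betw f (span (coset_roots x)) (span (A2_1_real_roots \<epsilon> \<delta>))"
    unfolding image[symmetric] linear_span_image[OF f]
    using inj_on_subset[OF inj subset_UNIV] by (simp add: bij_betw_def)
  then show ?thesis
    unfolding root_isomorphic_def using f image by (intro exI[of _ f]) (simp add: cartan_int_def form)
qed

lemma coset_roots_type: "of_type_A2_1 B \<epsilon> \<delta> (coset_roots x)"
  unfolding of_type_A2_1_def
  by (intro conjI coset_roots_subroot_system coset_roots_irreducible coset_roots_isomorphic)

end

lemma not_dvd_three_iff_cong: "\<not> 3 dvd (l::int) \<longleftrightarrow> [l = 1] (mod 3) \<or> [l = 2] (mod 3)"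
  unfolding cong_def by presburger

theorem proposition8p3p1:
  fixes B :: "'v::real_vector \<Rightarrow> 'v \<Rightarrow> real"
    and \<epsilon> :: "nat \<Rightarrow> 'v"
    and \<delta> :: 'v
  assumes "affine_setting B \<epsilon> \<delta>"
  shows "(\<forall>\<Psi> \<subseteq> D4_3_real_roots \<epsilon> \<delta>.
            maximal_closed_subroot_system B (D4_3_real_roots \<epsilon> \<delta>) \<Psi> \<and>
            gradient \<epsilon> \<delta> \<Psi> \<noteq> G2_roots \<epsilon> \<and> semi_closed B \<epsilon> (gradient \<epsilon> \<delta> \<Psi>)
          \<longleftrightarrow>
            gradient \<epsilon> \<delta> \<Psi> = G2_short \<epsilon> \<and>
            (\<exists>i j k. \<exists>l::int. {i,j,k} = {1,2,3} \<and> ([l = 1] (mod 3) \<or> [l = 2] (mod 3)) \<and>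
               \<Psi> = Psi_roots \<epsilon> \<delta> i j k l))
       \<and> (\<forall>i j k. \<forall>l::int. {i,j,k} = {1,2,3} \<longrightarrow> of_type_A2_1 B \<epsilon> \<delta> (Psi_roots \<epsilon> \<delta> i j k l))"
proof -
  interpret affine_setting B \<epsilon> \<delta> by fact
  show ?thesis
    unfolding three_def[symmetric] not_dvd_three_iff_cong[symmetric]
  proof (intro conjI allI impI iffI; (elim conjE exE)?)
    fix \<Psi> assume max: "maximal_closed_subroot_system B \<Phi> \<Psi>"
      and "semi_closed B \<epsilon> (gradient \<epsilon> \<delta> \<Psi>)"
    then show gr: "gradient \<epsilon> \<delta> \<Psi> = G2_short \<epsilon>" by (intro semi_closed_eq_short)
    obtain x where "\<not> 3 dvd sum x three" "\<Psi> = coset_roots x"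
      using maximal_with_short_gradient[OF max gr] .
    then show "\<exists>i j k. \<exists>l::int. {i,j,k} = three \<and> \<not> 3 dvd l \<and> \<Psi> = Psi_roots \<epsilon> \<delta> i j k l"
      using coset_roots_is_Psi_roots by metis
  next
    fix \<Psi> i j k and l :: int
    assume gr: "gradient \<epsilon> \<delta> \<Psi> = G2_short \<epsilon>" and p: "{i,j,k} = three" and l: "\<not> 3 dvd l"
      and \<Psi>: "\<Psi> = Psi_roots \<epsilon> \<delta> i j k l"
    let ?x = "\<lambda>a. if a = k then 0 else l"
    have "\<not> 3 dvd sum ?x three"
      using l permutation_three[OF p] unfolding sum_three[OF p] by simp presburger
    then show "maximal_closed_subroot_system B \<Phi> \<Psi>"
      unfolding \<Psi> Psi_roots_eq_coset_roots[OF p] by (rule coset_roots_maximal)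
    show "gradient \<epsilon> \<delta> \<Psi> \<noteq> G2_roots \<epsilon>" "semi_closed B \<epsilon> (gradient \<epsilon> \<delta> \<Psi>)"
      unfolding gr by (rule G2_short_proper G2_short_semi_closed)+
  next
    fix i j k and l :: int assume p: "{i,j,k} = three"
    show "of_type_A2_1 B \<epsilon> \<delta> (Psi_roots \<epsilon> \<delta> i j k l)"
      unfolding Psi_roots_eq_coset_roots[OF p] by (rule coset_roots_type)
  qed
qed

end
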